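(* Let $C\subseteq\{H,N,R,L,Fa,Fu\}$ and let $\mathcal{A}\in\mathcal{V}(C)$. Then $\mathcal{N}(\mathcal{A})=(\mathcal{N}(\mathsf{A}),\nabla,\to)$ belongs to $\mathcal{V}(C)$ and the canonical embedding $i:\mathcal{A}\to\mathcal{N}(\mathcal{A})$, $i(x)=(x]$, is a $\nabla$-algebra embedding. If $H\in C$, then $i$ is also a Heyting $\nabla$-algebra morphism. (In this sense, $\mathcal{V}(C)$ is closed under the Dedekind-MacNeille completion.)
   Context: A $\nabla$-algebra is a tuple $\mathcal{A}=(\mathsf{A},\nabla,\to)$ where $\mathsf{A}=(A,\wedge,\vee,0,1)$ is a bounded lattice, $\nabla$ is a unary and $\to$ a binary operation on $A$, such that for all $a,b,c\in A$: $\nabla c\wedge a\leq b$ iff $c\leq a\to b$. Put $\Box a:=1\to a$. Conditions on a $\nabla$-algebra: $(H)$ a Heyting implication exists on $\mathsf{A}$ (not necessarily equal to $\to$); $(N)$ $\nabla 1=1$ and $\nabla(a\wedge b)=\nabla a\wedge\nabla b$ for all $a,b$; $(R)$ $a\leq\nabla a$ for all $a$; $(L)$ $\nabla a\leq a$ for all $a$; $(Fa)$ $\nabla$ is surjective; $(Fu)$ $\Box$ is surjective. $\mathcal{V}(C)$ is the class of all $\nabla$-algebras satisfying all conditions in $C$. A $\nabla$-algebra morphism is a bounded lattice morphism preserving $\nabla$ and $\to$; it is an embedding if it is injective; it is a Heyting $\nabla$-algebra morphism if it moreover preserves the Heyting implication. For $S\subseteq A$, let $U(S)$ and $L(S)$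 be the sets of all upper bounds and all lower bounds of $S$ in $A$. A subset $N\subseteq A$ is normal if $LU(N)=N$ (such an $N$ is an ideal of $\mathsf{A}$). The Dedekind-MacNeille completion $\mathcal{N}(\mathsf{A})$ is the set of normal subsets of $A$ ordered by inclusion; it is a complete lattice with intersection as meet and $\bigvee_{i}N_i=LU(\bigcup_i N_i)$ as join. Write $(x]=\{y\in A\mid y\leq x\}$. On $\mathcal{N}(\mathsf{A})$ define $\nabla N=\bigvee_{n\in N}(\nabla n]$ and $M\to N=\{x\in A\mid \forall m\in M,\ \nabla x\wedge m\in N\}$. *)

theory Defs
  imports "HOL-Algebra.Complete_Lattice"
begin

section \<open>Nabla-algebras\<close>

record 'a nabla_alg = "'a gorder" +
  nabla :: "'a \<Rightarrow> 'a"  (\<open>\<nabla>\<index> _\<close> [90] 90)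
  arrow :: "'a \<Rightarrow> 'a \<Rightarrow> 'a"  (infixr \<open>\<leadsto>\<index>\<close> 60)

locale nabla_algebra = bounded_lattice A for A (structure) +
  assumes nabla_closed: "nabla A \<in> carrier A \<rightarrow> carrier A"
    and arrow_closed: "arrow A \<in> carrier A \<rightarrow> carrier A \<rightarrow> carrier A"
    and adjunction:
      "\<lbrakk>a \<in> carrier A; b \<in> carrier A; c \<in> carrier A\<rbrakk>
        \<Longrightarrow> \<nabla> c \<sqinter> a \<sqsubseteq> b \<longleftrightarrow> c \<sqsubseteq> a \<leadsto> b"

definition box :: "('a, 'm) nabla_alg_scheme \<Rightarrow> 'a \<Rightarrow> 'a"  (\<open>\<box>\<index> _\<close> [90] 90)
  where "\<box>\<^bsub>A\<^esub> a = \<top>\<^bsub>A\<^esub> \<leadsto>\<^bsub>A\<^esub> a"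

text \<open>Such an \<open>h\<close> is uniquely determined on the carrier; it is unrelated to the operation \<open>\<leadsto>\<close>.\<close>

definition is_heyting_imp :: "('a, 'm) gorder_scheme \<Rightarrow> ('a \<Rightarrow> 'a \<Rightarrow> 'a) \<Rightarrow> bool"
  where "is_heyting_imp A h \<longleftrightarrow>
    h \<in> carrier A \<rightarrow> carrier A \<rightarrow> carrier A \<and>
    (\<forall>a \<in> carrier A. \<forall>b \<in> carrier A. \<forall>c \<in> carrier A.
      c \<sqinter>\<^bsub>A\<^esub> a \<sqsubseteq>\<^bsub>A\<^esub> b \<longleftrightarrow> c \<sqsubseteq>\<^bsub>A\<^esub> h a b)"


section \<open>The conditions and the classes they define\<close>

datatype condition = Cond_H | Cond_N | Cond_R | Cond_L | Cond_Fa | Cond_Fu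

fun satisfies :: "('a, 'm) nabla_alg_scheme \<Rightarrow> condition \<Rightarrow> bool"
  where
    "satisfies A Cond_H \<longleftrightarrow> (\<exists>h. is_heyting_imp A h)"
  | "satisfies A Cond_N \<longleftrightarrow>
      \<nabla>\<^bsub>A\<^esub> \<top>\<^bsub>A\<^esub> = \<top>\<^bsub>A\<^esub> \<and>
      (\<forall>a \<in> carrier A. \<forall>b \<in> carrier A. \<nabla>\<^bsub>A\<^esub> (a \<sqinter>\<^bsub>A\<^esub> b) = \<nabla>\<^bsub>A\<^esub> a \<sqinter>\<^bsub>A\<^esub> \<nabla>\<^bsub>A\<^esub> b)"
  | "satisfies A Cond_R \<longleftrightarrow> (\<forall>a \<in> carrier A. a \<sqsubseteq>\<^bsub>A\<^esub> \<nabla>\<^bsub>A\<^esub> a)"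
  | "satisfies A Cond_L \<longleftrightarrow> (\<forall>a \<in> carrier A. \<nabla>\<^bsub>A\<^esub> a \<sqsubseteq>\<^bsub>A\<^esub> a)"
  | "satisfies A Cond_Fa \<longleftrightarrow> nabla A ` carrier A = carrier A"
  | "satisfies A Cond_Fu \<longleftrightarrow> box A ` carrier A = carrier A"

definition variety :: "condition set \<Rightarrow> ('a, 'm) nabla_alg_scheme set"
  where "variety C = {A. nabla_algebra A \<and> (\<forall>c \<in> C. satisfies A c)}"


section \<open>Morphisms\<close>

definition nabla_morphism ::
    "('a, 'm) nabla_alg_scheme \<Rightarrow> ('b, 'n) nabla_alg_scheme \<Rightarrow> ('a \<Rightarrow> 'b) \<Rightarrow> bool"
  where "nabla_morphism A B f \<longleftrightarrow>
    nabla_algebra A \<and> nabla_algebra B \<and>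
    f \<in> carrier A \<rightarrow> carrier B \<and>
    meet_pres A B f \<and> join_pres A B f \<and>
    f \<bottom>\<^bsub>A\<^esub> = \<bottom>\<^bsub>B\<^esub> \<and> f \<top>\<^bsub>A\<^esub> = \<top>\<^bsub>B\<^esub> \<and>
    (\<forall>a \<in> carrier A. f (\<nabla>\<^bsub>A\<^esub> a) = \<nabla>\<^bsub>B\<^esub> (f a)) \<and>
    (\<forall>a \<in> carrier A. \<forall>b \<in> carrier A. f (a \<leadsto>\<^bsub>A\<^esub> b) = f a \<leadsto>\<^bsub>B\<^esub> f b)"

definition nabla_embedding ::
    "('a, 'm) nabla_alg_scheme \<Rightarrow> ('b, 'n) nabla_alg_scheme \<Rightarrow> ('a \<Rightarrow> 'b) \<Rightarrow> bool"
  where "nabla_embedding A B f \<longleftrightarrow> nabla_morphism A B f \<and> inj_on f (carrier A)"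

text \<open>By uniqueness of Heyting implications, it does not matter which \<open>h\<close> and \<open>k\<close> are taken
  (they agree on the carriers); their existence is part of the definition.\<close>

definition heyting_nabla_morphism ::
    "('a, 'm) nabla_alg_scheme \<Rightarrow> ('b, 'n) nabla_alg_scheme \<Rightarrow> ('a \<Rightarrow> 'b) \<Rightarrow> bool"
  where "heyting_nabla_morphism A B f \<longleftrightarrow>
    nabla_morphism A B f \<and>
    (\<exists>h k. is_heyting_imp A h \<and> is_heyting_imp B k \<and>
      (\<forall>a \<in> carrier A. \<forall>b \<in> carrier A. f (h a b) = k (f a) (f b)))"


section \<open>The Dedekind-MacNeille completion\<close>

definition normal_sets :: "('a, 'm) gorder_scheme \<Rightarrow> 'a set set"
  where "normal_sets A = {N. N \<subseteq> carrier A \<and> Lower A (Upper A N) = N}"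

definition down :: "('a, 'm) gorder_scheme \<Rightarrow> 'a \<Rightarrow> 'a set"
  where "down A x = {y \<in> carrier A. y \<sqsubseteq>\<^bsub>A\<^esub> x}"

definition dm_lattice :: "('a, 'm) gorder_scheme \<Rightarrow> 'a set gorder"
  where "dm_lattice A = \<lparr>carrier = normal_sets A, eq = (=), le = (\<subseteq>)\<rparr>"

text \<open>The join in the definition of \<open>nabla\<close> is the one of the complete lattice of normal sets;
  lemma \<open>dm_lattice_sup\<close> below gives the explicit formula for it.\<close>

definition dm_completion :: "('a, 'm) nabla_alg_scheme \<Rightarrow> 'a set nabla_alg"
  where "dm_completion A =
    \<lparr>carrier = carrier (dm_lattice A), eq = eq (dm_lattice A), le = le (dm_lattice A),
     nabla = (\<lambda>N. \<Squnion>\<^bsub>dm_lattice A\<^esub> ((\<lambda>n. down A (\<nabla>\<^bsub>A\<^esub> n)) ` N)),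
     arrow = (\<lambda>M N. {x \<in> carrier A. \<forall>m \<in> M. \<nabla>\<^bsub>A\<^esub> x \<sqinter>\<^bsub>A\<^esub> m \<in> N})\<rparr>"

lemma LU_extensive: "S \<subseteq> carrier A \<Longrightarrow> S \<subseteq> Lower A (Upper A S)"
  by (auto simp: Lower_def Upper_def)

lemma LU_mono: "S \<subseteq> T \<Longrightarrow> Lower A (Upper A S) \<subseteq> Lower A (Upper A T)"
  by (auto simp: Lower_def Upper_def)

lemma LU_normal: "S \<subseteq> carrier A \<Longrightarrow> Lower A (Upper A S) \<in> normal_sets A"
  by (auto simp: normal_sets_def Lower_def Upper_def)

lemma Inter_normal:
  assumes "\<N> \<subseteq> normal_sets A" "\<N> \<noteq> {}"
  shows "\<Inter>\<N> \<in> normal_sets A"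
proof -
  have sub: "\<Inter>\<N> \<subseteq> carrier A" using assms by (auto simp: normal_sets_def)
  have "Lower A (Upper A (\<Inter>\<N>)) \<subseteq> N" if "N \<in> \<N>" for N
  proof -
    have "Lower A (Upper A (\<Inter>\<N>)) \<subseteq> Lower A (Upper A N)"
      using that by (intro LU_mono) blast
    moreover have "Lower A (Upper A N) = N" using that assms(1) unfolding normal_sets_def by blast
    ultimately show ?thesis by simp
  qed
  then have "Lower A (Upper A (\<Inter>\<N>)) \<subseteq> \<Inter>\<N>" by blast
  with LU_extensive[OF sub] have "Lower A (Upper A (\<Inter>\<N>)) = \<Inter>\<N>" by (rule subset_antisym[rotated])
  with sub show ?thesis by (simp add: normal_sets_def)
qed

lemma partial_order_dm_lattice: "partial_order (dm_lattice A)"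
  by unfold_locales (auto simp: dm_lattice_def)

lemma dm_lattice_is_sup:
  assumes "\<N> \<subseteq> normal_sets A"
  shows "least (dm_lattice A) (Lower A (Upper A (\<Union>\<N>))) (Upper (dm_lattice A) \<N>)"
proof -
  have sub: "\<Union>\<N> \<subseteq> carrier A" using assms by (auto simp: normal_sets_def)
  have "Lower A (Upper A (\<Union>\<N>)) \<subseteq> K" if "K \<in> normal_sets A" "\<Union>\<N> \<subseteq> K" for K
    using LU_mono[OF that(2), of A] that(1) by (auto simp: normal_sets_def)
  moreover have "\<Union>\<N> \<subseteq> K" if "K \<in> Upper (dm_lattice A) \<N>" for K
    using that assms by (auto simp: Upper_def dm_lattice_def)
  moreover have "Upper (dm_lattice A) \<N> \<subseteq> normal_sets A"
    by (auto simp: Upper_def dm_lattice_def)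
  moreover have mem: "Lower A (Upper A (\<Union>\<N>)) \<in> Upper (dm_lattice A) \<N>"
    using LU_normal[OF sub] LU_extensive[OF sub]
    unfolding Upper_def[of "dm_lattice A"] by (auto simp: dm_lattice_def)
  ultimately have "Lower A (Upper A (\<Union>\<N>)) \<subseteq> K" if "K \<in> Upper (dm_lattice A) \<N>" for K
    using that by blast
  with mem show ?thesis
    unfolding least_def by (simp add: dm_lattice_def Upper_def)
qed

lemma dm_lattice_is_inf:
  assumes "\<N> \<subseteq> normal_sets A" "\<N> \<noteq> {}"
  shows "greatest (dm_lattice A) (\<Inter>\<N>) (Lower (dm_lattice A) \<N>)"
  using assms Inter_normal[OF assms]
  by (auto simp: greatest_def Lower_def dm_lattice_def)

theorem complete_lattice_dm_lattice: "complete_lattice (dm_lattice A)"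
proof -
  interpret partial_order "dm_lattice A" by (rule partial_order_dm_lattice)
  have top: "carrier A \<in> normal_sets A"
    using LU_extensive[of "carrier A" A] by (auto simp: normal_sets_def Lower_def)
  have "greatest (dm_lattice A) (carrier A) (Lower (dm_lattice A) {})"
    using top by (auto simp: greatest_def Lower_def dm_lattice_def normal_sets_def)
  then have inf: "\<exists>i. greatest (dm_lattice A) i (Lower (dm_lattice A) \<N>)"
    if "\<N> \<subseteq> normal_sets A" for \<N>
    using dm_lattice_is_inf[OF that] by (cases "\<N> = {}") blast+
  have carr: "carrier (dm_lattice A) = normal_sets A" by (simp add: dm_lattice_def)
  show ?thesis
  proof
    fix \<N> assume "\<N> \<subseteq> carrier (dm_lattice A)"
    then have N: "\<N> \<subseteq> normal_sets A" by (simp only: carr)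
    show "\<exists>s. least (dm_lattice A) s (Upper (dm_lattice A) \<N>)"
      by (rule exI) (rule dm_lattice_is_sup[OF N])
    show "\<exists>i. greatest (dm_lattice A) i (Lower (dm_lattice A) \<N>)"
      by (rule inf[OF N])
  qed
qed

theorem dm_lattice_sup:
  assumes "\<N> \<subseteq> normal_sets A"
  shows "\<Squnion>\<^bsub>dm_lattice A\<^esub> \<N> = Lower A (Upper A (\<Union>\<N>))"
  unfolding sup_def
  by (rule some_equality, rule dm_lattice_is_sup[OF assms])
    (rule partial_order.least_unique[OF partial_order_dm_lattice _ dm_lattice_is_sup[OF assms]])

theorem dm_lattice_inf:
  assumes "\<N> \<subseteq> normal_sets A" "\<N> \<noteq> {}"
  shows "\<Sqinter>\<^bsub>dm_lattice A\<^esub> \<N> = \<Inter>\<N>"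
  unfolding Lattice.inf_def
  by (rule some_equality, rule dm_lattice_is_inf[OF assms])
    (rule partial_order.greatest_unique[OF partial_order_dm_lattice _ dm_lattice_is_inf[OF assms]])

end

theory Submission
  imports Defs
begin

text \<open>
  The adjunction on \<open>\<N>(A)\<close> and the preservation of \<open>N\<close> rest on one argument, which
  replaces distributivity by the residual: if \<open>\<nabla>p \<and> z \<le> u\<close> for all \<open>p \<in> P\<close>, then
  \<open>p \<le> z \<rightarrow> u\<close> for all \<open>p\<close>, so \<open>\<nabla>(z \<rightarrow> u)\<close> is an upper bound of \<open>\<nabla>[P]\<close> and every
  \<open>y \<in> \<nabla>P = LU(\<nabla>[P])\<close> satisfies \<open>y \<and> z \<le> \<nabla>(z \<rightarrow> u) \<and> z \<le> u\<close>.
  Conversely, \<open>M \<rightarrow> N\<close> is normal because it is the intersection of the principal ideals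
  \<open>(m \<rightarrow> u]\<close> for \<open>m \<in> M\<close> and \<open>u \<in> U(N)\<close>. The Heyting implication of \<open>\<N>(A)\<close> is the same
  construction with the identity in place of \<open>\<nabla>\<close>. The conditions \<open>Fa\<close> and \<open>Fu\<close> say that
  \<open>\<nabla>\<box> = id\<close> and \<open>\<box>\<nabla> = id\<close> respectively, and both identities lift to normal sets.
\<close>

section \<open>Normal sets\<close>

lemma normal_sets_subset: "N \<in> normal_sets A \<Longrightarrow> N \<subseteq> carrier A"
  by (simp add: normal_sets_def)

text \<open>\<open>Upper\<close> compares only with elements in the carrier; the inclusion of
  \<open>S\<close> in the carrier is what lets the quantifier run over all of
  \<open>S\<close>.\<close>

lemma mem_LU_iff:
  assumes "S \<subseteq> carrier A"
  shows "y \<in> Lower A (Upper A S) \<longleftrightarrow>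
    y \<in> carrier A \<and> (\<forall>u \<in> carrier A. (\<forall>s \<in> S. s \<sqsubseteq>\<^bsub>A\<^esub> u) \<longrightarrow> y \<sqsubseteq>\<^bsub>A\<^esub> u)"
proof -
  have "Upper A S = {u \<in> carrier A. \<forall>s \<in> S. s \<sqsubseteq>\<^bsub>A\<^esub> u}"
    using assms by (auto simp: Upper_def)
  then show ?thesis by (auto simp: Lower_def)
qed

lemma mem_normal_iff:
  assumes "N \<in> normal_sets A"
  shows "y \<in> N \<longleftrightarrow>
    y \<in> carrier A \<and> (\<forall>u \<in> carrier A. (\<forall>n \<in> N. n \<sqsubseteq>\<^bsub>A\<^esub> u) \<longrightarrow> y \<sqsubseteq>\<^bsub>A\<^esub> u)"
proof -
  have "Lower A (Upper A N) = N" using assms by (simp add: normal_sets_def)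
  then show ?thesis using mem_LU_iff[OF normal_sets_subset[OF assms], of y] by simp
qed

text \<open>The closure \<open>LU\<close> is extensive, so only the inclusion of
  \<open>LU(N)\<close> in \<open>N\<close> remains to be checked.\<close>

lemma normal_setsI:
  assumes "N \<subseteq> carrier A"
    and "\<And>y. \<lbrakk>y \<in> carrier A; \<And>u. \<lbrakk>u \<in> carrier A; \<forall>n \<in> N. n \<sqsubseteq>\<^bsub>A\<^esub> u\<rbrakk> \<Longrightarrow> y \<sqsubseteq>\<^bsub>A\<^esub> u\<rbrakk> \<Longrightarrow> y \<in> N"
  shows "N \<in> normal_sets A"
proof -
  have "Lower A (Upper A N) \<subseteq> N"
    using assms(2) by (auto simp: mem_LU_iff[OF assms(1)])
  then show ?thesis using assms(1) LU_extensive[OF assms(1)] by (auto simp: normal_sets_def)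
qed

text \<open>By transitivity \<open>y\<close> lies below every upper bound of \<open>N\<close>,
  because \<open>x\<close> does.\<close>

lemma (in weak_partial_order) normal_sets_downward:
  assumes "N \<in> normal_sets L" "x \<in> N" "y \<in> carrier L" "y \<sqsubseteq> x"
  shows "y \<in> N"
  unfolding mem_normal_iff[OF assms(1)]
  using assms normal_sets_subset[OF assms(1)] by (blast intro: le_trans)

text \<open>The point \<open>x\<close> is itself an upper bound of its ideal, so anything below all
  upper bounds lies below \<open>x\<close>.\<close>

lemma (in weak_partial_order) down_normal: "x \<in> carrier L \<Longrightarrow> down L x \<in> normal_sets L"
  by (rule normal_setsI) (auto simp: down_def)

lemma (in partial_order) inj_on_down: "inj_on (down L) (carrier L)"
proof (rule inj_onI)
  fix x y assume c: "x \<in> carrier L" "y \<in> carrier L" and eq: "down L x = down L y"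
  have "x \<in> down L x" "y \<in> down L y" using c by (simp_all add: down_def)
  then have "x \<sqsubseteq> y" "y \<sqsubseteq> x" using eq by (auto simp: down_def)
  then show "x = y" using c by (simp add: le_antisym)
qed

section \<open>Residuals, meets and joins of principal ideals\<close>

context lattice
begin

text \<open>Formulated for an arbitrary \<open>f\<close> with residual \<open>g\<close> because it
  serves twice: \<open>nabla\<close> with \<open>arrow\<close> gives the arrow of the completion,
  the identity with a Heyting implication of the lattice gives its Heyting implication.\<close>

lemma residual_normal:
  assumes f: "f \<in> carrier L \<rightarrow> carrier L" and g: "g \<in> carrier L \<rightarrow> carrier L \<rightarrow> carrier L"
    and adj: "\<And>a b c. \<lbrakk>a \<in> carrier L; b \<in> carrier L; c \<in> carrier L\<rbrakk> \<Longrightarrow>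
      f c \<sqinter> a \<sqsubseteq> b \<longleftrightarrow> c \<sqsubseteq> g a b"
    and M: "M \<subseteq> carrier L" and N: "N \<in> normal_sets L"
  shows "{x \<in> carrier L. \<forall>m \<in> M. f x \<sqinter> m \<in> N} \<in> normal_sets L" (is "?R \<in> _")
proof (rule normal_setsI)
  show "?R \<subseteq> carrier L" by blast
  fix y assume y: "y \<in> carrier L"
    and below: "\<And>u. \<lbrakk>u \<in> carrier L; \<forall>x \<in> ?R. x \<sqsubseteq> u\<rbrakk> \<Longrightarrow> y \<sqsubseteq> u"
  have "f y \<sqinter> m \<in> N" if m: "m \<in> M" for m
  proof -
    have mc: "m \<in> carrier L" using m M by blast
    have "f y \<sqinter> m \<sqsubseteq> u" if u: "u \<in> carrier L" "\<forall>n \<in> N. n \<sqsubseteq> u" for u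
    proof -
      \<comment> \<open>The residual supplies an upper bound of \<open>?R\<close>: for
        \<open>x\<close> in \<open>?R\<close> the element \<open>f x \<sqinter> m\<close> of
        \<open>N\<close> lies below \<open>u\<close>, and the adjunction turns this into a bound on
        \<open>x\<close>.\<close>
      have "\<forall>x \<in> ?R. x \<sqsubseteq> g m u" using m u by (simp add: adj[OF mc u(1), symmetric])
      moreover have "g m u \<in> carrier L" using g mc u by blast
      ultimately have "y \<sqsubseteq> g m u" by (rule below[rotated])
      then show ?thesis by (simp add: adj[OF mc u(1) y])
    qed
    moreover have "f y \<sqinter> m \<in> carrier L" using f y mc by (blast intro: meet_closed)
    ultimately show ?thesis unfolding mem_normal_iff[OF N] by blast
  qed
  with y show "y \<in> ?R" by blast
qed

text \<open>The test at \<open>m = a\<close> is the strongest one, since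
  \<open>f x \<sqinter> m\<close> grows with \<open>m\<close>; the adjunction rewrites it as a bound
  on \<open>x\<close>. This is why the canonical embedding preserves the arrow and the Heyting
  implication.\<close>

lemma residual_down:
  assumes f: "f \<in> carrier L \<rightarrow> carrier L"
    and adj: "\<And>a b c. \<lbrakk>a \<in> carrier L; b \<in> carrier L; c \<in> carrier L\<rbrakk> \<Longrightarrow>
      f c \<sqinter> a \<sqsubseteq> b \<longleftrightarrow> c \<sqsubseteq> g a b"
    and ab: "a \<in> carrier L" "b \<in> carrier L"
  shows "{x \<in> carrier L. \<forall>m \<in> down L a. f x \<sqinter> m \<in> down L b} = down L (g a b)"
proof -
  have "(\<forall>m \<in> down L a. f x \<sqinter> m \<in> down L b) \<longleftrightarrow> f x \<sqinter> a \<sqsubseteq> b" if x: "x \<in> carrier L" for x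
  proof
    have fx: "f x \<in> carrier L" using f x by blast
    show "f x \<sqinter> a \<sqsubseteq> b" if "\<forall>m \<in> down L a. f x \<sqinter> m \<in> down L b"
      using that ab by (auto simp: down_def)
    assume le: "f x \<sqinter> a \<sqsubseteq> b"
    have "f x \<sqinter> m \<sqsubseteq> b" if m: "m \<in> carrier L" "m \<sqsubseteq> a" for m
    proof -
      have "f x \<sqinter> m \<sqsubseteq> f x \<sqinter> a"
        using fx m ab by (meson le_trans meet_closed meet_le meet_left meet_right)
      with le show ?thesis using fx m ab by (meson le_trans meet_closed)
    qed
    then show "\<forall>m \<in> down L a. f x \<sqinter> m \<in> down L b" using fx by (auto simp: down_def)
  qed
  then have "{x \<in> carrier L. \<forall>m \<in> down L a. f x \<sqinter> m \<in> down L b} =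
      {x \<in> carrier L. f x \<sqinter> a \<sqsubseteq> b}" by blast
  also have "\<dots> = down L (g a b)" using adj ab by (auto simp: down_def)
  finally show ?thesis .
qed

lemma down_meet: "\<lbrakk>a \<in> carrier L; b \<in> carrier L\<rbrakk> \<Longrightarrow> down L (a \<sqinter> b) = down L a \<inter> down L b"
  unfolding down_def
  by (auto intro: meet_le le_trans[OF _ meet_left] le_trans[OF _ meet_right])

text \<open>The union of the two ideals has as upper bounds exactly the elements above
  \<open>a \<squnion> b\<close>, so its \<open>LU\<close> closure is principal.\<close>

lemma down_join:
  assumes "a \<in> carrier L" "b \<in> carrier L"
  shows "down L (a \<squnion> b) = Lower L (Upper L (down L a \<union> down L b))"
proof -
  have sub: "down L a \<union> down L b \<subseteq> carrier L" by (auto simp: down_def)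
  have bound: "(\<forall>s \<in> down L a \<union> down L b. s \<sqsubseteq> u) \<longleftrightarrow> a \<squnion> b \<sqsubseteq> u" if u: "u \<in> carrier L" for u
  proof
    show "a \<squnion> b \<sqsubseteq> u" if "\<forall>s \<in> down L a \<union> down L b. s \<sqsubseteq> u"
      using that assms u by (intro join_le) (auto simp: down_def)
    show "\<forall>s \<in> down L a \<union> down L b. s \<sqsubseteq> u" if "a \<squnion> b \<sqsubseteq> u"
    proof -
      have "a \<sqsubseteq> u" "b \<sqsubseteq> u"
        using that assms u by (meson join_closed join_left join_right le_trans)+
      then show ?thesis using assms u unfolding down_def by (blast intro: le_trans)
    qed
  qed
  show ?thesis
    unfolding set_eq_iff mem_LU_iff[OF sub] using bound assms
    by (auto simp: down_def[of L "a \<squnion> b"] intro: le_trans)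
qed

end


section \<open>The lattice reduct of the completion\<close>

lemma carrier_dm_completion [simp]: "carrier (dm_completion A) = normal_sets A"
  and le_dm_completion [simp]: "le (dm_completion A) = (\<subseteq>)"
  and eq_dm_completion [simp]: "eq (dm_completion A) = (=)"
  and arrow_dm_completion: "arrow (dm_completion A) M N =
    {x \<in> carrier A. \<forall>m \<in> M. \<nabla>\<^bsub>A\<^esub> x \<sqinter>\<^bsub>A\<^esub> m \<in> N}"
  by (simp_all add: dm_completion_def dm_lattice_def)

text \<open>These notions depend only on the carrier and the order, so all facts on suprema and
  infima of normal sets carry over to the record extended by the operations.\<close>

lemma dm_completion_order:
  "least (dm_completion A) = least (dm_lattice A)"
  "greatest (dm_completion A) = greatest (dm_lattice A)"
  "Upper (dm_completion A) = Upper (dm_lattice A)"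
  "Lower (dm_completion A) = Lower (dm_lattice A)"
  by (simp_all add: fun_eq_iff least_def greatest_def Upper_def Lower_def dm_lattice_def)

lemma complete_lattice_dm_completion: "complete_lattice (dm_completion A)"
proof -
  interpret D: complete_lattice "dm_lattice A" by (rule complete_lattice_dm_lattice)
  have carr: "carrier (dm_lattice A) = normal_sets A" by (simp add: dm_lattice_def)
  show ?thesis
    by unfold_locales
      (use D.sup_exists D.inf_exists in \<open>auto simp: dm_completion_order carr\<close>)
qed

lemma bounded_lattice_dm_completion: "bounded_lattice (dm_completion A)"
proof -
  interpret complete_lattice "dm_completion A" by (rule complete_lattice_dm_completion)
  show ?thesis by unfold_locales
qed

lemma meet_dm_completion:
  assumes "M \<in> normal_sets A" "N \<in> normal_sets A"
  shows "M \<sqinter>\<^bsub>dm_completion A\<^esub> N = M \<inter> N"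
  using dm_lattice_inf[of "{M, N}" A] assms
  by (simp add: meet_def Lattice.inf_def dm_completion_order)

lemma join_dm_completion:
  assumes "M \<in> normal_sets A" "N \<in> normal_sets A"
  shows "M \<squnion>\<^bsub>dm_completion A\<^esub> N = Lower A (Upper A (M \<union> N))"
  using dm_lattice_sup[of "{M, N}" A] assms
  by (simp add: join_def sup_def dm_completion_order)

lemma carrier_normal: "carrier A \<in> normal_sets A"
  by (rule normal_setsI) auto

lemma top_dm_completion: "\<top>\<^bsub>dm_completion A\<^esub> = carrier A"
proof -
  interpret bounded_lattice "dm_completion A" by (rule bounded_lattice_dm_completion)
  show ?thesis
    by (rule top_eq[symmetric]) (auto simp: carrier_normal dest: normal_sets_subset)
qed

text \<open>The element \<open>\<bottom>\<close> lies below every upper bound and hence belongs to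
  every normal set; the least normal set is therefore its ideal rather than the empty set.\<close>

lemma bottom_dm_completion:
  assumes "bounded_lattice A"
  shows "\<bottom>\<^bsub>dm_completion A\<^esub> = down A \<bottom>\<^bsub>A\<^esub>"
proof -
  interpret A: bounded_lattice A by (rule assms)
  interpret bounded_lattice "dm_completion A" by (rule bounded_lattice_dm_completion)
  have "down A \<bottom>\<^bsub>A\<^esub> \<subseteq> N" if N: "N \<in> normal_sets A" for N
    unfolding subset_eq mem_normal_iff[OF N]
    by (auto simp: down_def intro: A.le_trans[OF _ A.bottom_lower])
  then show ?thesis by (intro bottom_eq[symmetric]) (auto simp: A.down_normal)
qed

lemma (in bounded_lattice) down_top: "down L \<top> = carrier L"
  by (auto simp: down_def)


section \<open>The operations of the completion\<close>

context nabla_algebra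
begin

lemma nabla_in_carrier [simp]: "a \<in> carrier A \<Longrightarrow> \<nabla> a \<in> carrier A"
  using nabla_closed by blast

lemma arrow_in_carrier [simp]: "\<lbrakk>a \<in> carrier A; b \<in> carrier A\<rbrakk> \<Longrightarrow> a \<leadsto> b \<in> carrier A"
  using arrow_closed by blast

lemma box_in_carrier [simp]: "a \<in> carrier A \<Longrightarrow> \<box> a \<in> carrier A"
  by (simp add: box_def)

section \<open>Nabla and box as an adjoint pair\<close>

lemma meet_top:
  assumes "a \<in> carrier A"
  shows "a \<sqinter> \<top> = a"
  using assms top_meet[of a] by (simp add: meet_comm eq_is_equal)

text \<open>The adjunction with \<open>\<top>\<close> as antecedent, which makes
  \<open>nabla\<close> left adjoint to \<open>box\<close>.\<close>

lemma nabla_le_iff: "\<lbrakk>a \<in> carrier A; b \<in> carrier A\<rbrakk> \<Longrightarrow> \<nabla> a \<sqsubseteq> b \<longleftrightarrow> a \<sqsubseteq> \<box> b"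
  using adjunction[of "\<top>" b a] by (simp add: box_def meet_top)

lemma nabla_mono:
  assumes "a \<in> carrier A" "b \<in> carrier A" "a \<sqsubseteq> b"
  shows "\<nabla> a \<sqsubseteq> \<nabla> b"
proof -
  \<comment> \<open>The unit of the adjunction; composing it with \<open>a \<sqsubseteq> b\<close>
    and transposing gives monotonicity.\<close>
  have "b \<sqsubseteq> \<box> \<nabla> b" using assms by (simp add: nabla_le_iff[symmetric])
  then show ?thesis using assms by (auto simp: nabla_le_iff intro: le_trans)
qed

section \<open>Nabla on normal sets\<close>

lemma mem_nabla_dm_completion:
  assumes N: "N \<in> normal_sets A"
  shows "y \<in> \<nabla>\<^bsub>dm_completion A\<^esub> N \<longleftrightarrow>
    y \<in> carrier A \<and> (\<forall>u \<in> carrier A. (\<forall>n \<in> N. \<nabla> n \<sqsubseteq> u) \<longrightarrow> y \<sqsubseteq> u)"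
proof -
  have Nc: "N \<subseteq> carrier A" using N by (rule normal_sets_subset)
  let ?F = "(\<lambda>n. down A (\<nabla> n)) ` N"
  have "?F \<subseteq> normal_sets A" using Nc by (blast intro: down_normal nabla_in_carrier)
  then have eq: "\<nabla>\<^bsub>dm_completion A\<^esub> N = Lower A (Upper A (\<Union>?F))"
    by (simp add: dm_completion_def dm_lattice_sup)
  have sub: "\<Union>?F \<subseteq> carrier A" by (auto simp: down_def)
  \<comment> \<open>A principal ideal is bounded by \<open>u\<close> as soon as its greatest element
    is, so the union of the ideals has the same upper bounds as the image of \<open>N\<close> under
    \<open>nabla\<close>.\<close>
  have "(\<forall>s \<in> \<Union>?F. s \<sqsubseteq> u) \<longleftrightarrow> (\<forall>n \<in> N. \<nabla> n \<sqsubseteq> u)" if u: "u \<in> carrier A" for u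
  proof -
    have "(\<forall>s \<in> down A (\<nabla> n). s \<sqsubseteq> u) \<longleftrightarrow> \<nabla> n \<sqsubseteq> u" if "n \<in> N" for n
    proof -
      have "\<nabla> n \<in> carrier A" using that Nc by (simp add: subset_iff)
      then show ?thesis using u by (auto simp: down_def intro: le_trans)
    qed
    then show ?thesis by simp
  qed
  then show ?thesis by (simp only: eq mem_LU_iff[OF sub] cong: conj_cong ball_cong)
qed

text \<open>By the membership criterion, every upper bound of the image of \<open>N\<close> under
  \<open>nabla\<close> is also an upper bound of \<open>?K\<close>.\<close>

lemma nabla_dm_completion_normal:
  assumes "N \<in> normal_sets A"
  shows "\<nabla>\<^bsub>dm_completion A\<^esub> N \<in> normal_sets A"
    (is "?K \<in> _")
proof (rule normal_setsI)
  show "?K \<subseteq> carrier A" by (simp add: mem_nabla_dm_completion[OF assms] subset_iff)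
  fix y assume y: "y \<in> carrier A"
    and below: "\<And>u. \<lbrakk>u \<in> carrier A; \<forall>n \<in> ?K. n \<sqsubseteq> u\<rbrakk> \<Longrightarrow> y \<sqsubseteq> u"
  have "y \<sqsubseteq> u" if "u \<in> carrier A" "\<forall>n \<in> N. \<nabla> n \<sqsubseteq> u" for u
    using that by (intro below) (simp_all add: mem_nabla_dm_completion[OF assms])
  with y show "y \<in> ?K" by (simp add: mem_nabla_dm_completion[OF assms])
qed

lemma nabla_mem_nabla_dm_completion:
  assumes "N \<in> normal_sets A" "n \<in> N"
  shows "\<nabla> n \<in> \<nabla>\<^bsub>dm_completion A\<^esub> N"
proof -
  have "\<nabla> n \<in> carrier A"
    using nabla_in_carrier[OF subsetD[OF normal_sets_subset[OF assms(1)] assms(2)]] .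
  with assms(2) show ?thesis unfolding mem_nabla_dm_completion[OF assms(1)] by (intro conjI) fast+
qed

text \<open>Every upper bound of \<open>N\<close> bounds the image of \<open>M\<close> under
  \<open>nabla\<close>, hence lies above each member of the join.\<close>

lemma nabla_dm_completion_least:
  assumes "M \<in> normal_sets A" "N \<in> normal_sets A" "\<And>m. m \<in> M \<Longrightarrow> \<nabla> m \<in> N"
  shows "\<nabla>\<^bsub>dm_completion A\<^esub> M \<subseteq> N"
proof
  fix y assume "y \<in> \<nabla>\<^bsub>dm_completion A\<^esub> M"
  then have yc: "y \<in> carrier A"
    and below: "\<forall>u \<in> carrier A. (\<forall>m \<in> M. \<nabla> m \<sqsubseteq> u) \<longrightarrow> y \<sqsubseteq> u"
    unfolding mem_nabla_dm_completion[OF assms(1)] by (rule conjunct1, rule conjunct2)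
  have "y \<sqsubseteq> u" if u: "u \<in> carrier A" "\<forall>n \<in> N. n \<sqsubseteq> u" for u
  proof -
    have "\<forall>m \<in> M. \<nabla> m \<sqsubseteq> u" by (rule ballI, rule bspec[OF u(2)], rule assms(3))
    then show ?thesis by (rule bspec[OF below u(1), THEN mp])
  qed
  then show "y \<in> N" unfolding mem_normal_iff[OF assms(2)] using yc by blast
qed

section \<open>The adjunction on the completion\<close>

lemma nabla_dm_completion_meet_le:
  assumes P: "P \<in> normal_sets A" and y: "y \<in> \<nabla>\<^bsub>dm_completion A\<^esub> P"
    and zu: "z \<in> carrier A" "u \<in> carrier A"
    and le: "\<And>p. p \<in> P \<Longrightarrow> \<nabla> p \<sqinter> z \<sqsubseteq> u"
  shows "y \<sqinter> z \<sqsubseteq> u"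
proof -
  have Pc: "P \<subseteq> carrier A" using P by (rule normal_sets_subset)
  have yc: "y \<in> carrier A" using P y by (simp add: mem_nabla_dm_completion)
  \<comment> \<open>The greatest element whose \<open>nabla\<close> meets \<open>z\<close> below
    \<open>u\<close>; it bounds all of \<open>P\<close>, so the single element
    \<open>\<nabla> ?c\<close> bounds the whole image of \<open>P\<close>.\<close>
  let ?c = "z \<leadsto> u"
  have "\<forall>p \<in> P. \<nabla> p \<sqsubseteq> \<nabla> ?c"
      proof
    fix p assume p: "p \<in> P"
    then have pc: "p \<in> carrier A" using Pc by (rule subsetD[rotated])
    then have "p \<sqsubseteq> ?c" using zu le[OF p] by (simp add: adjunction)
    with pc zu show "\<nabla> p \<sqsubseteq> \<nabla> ?c" by (simp add: nabla_mono)
  qed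
  then have "y \<sqsubseteq> \<nabla> ?c" using P y zu by (simp add: mem_nabla_dm_completion)
  then have "y \<sqinter> z \<sqsubseteq> \<nabla> ?c \<sqinter> z"
    using yc zu
    by (meson arrow_in_carrier le_trans meet_closed meet_le meet_left meet_right nabla_in_carrier)
  moreover have "\<nabla> ?c \<sqinter> z \<sqsubseteq> u" using zu by (simp add: adjunction)
  ultimately show ?thesis using yc zu by (meson le_trans meet_closed nabla_in_carrier arrow_in_carrier)
qed

lemma arrow_dm_completion_normal:
  assumes "M \<in> normal_sets A" "N \<in> normal_sets A"
  shows "M \<leadsto>\<^bsub>dm_completion A\<^esub> N \<in> normal_sets A"
  unfolding arrow_dm_completion
  by (rule residual_normal[OF nabla_closed arrow_closed adjunction
        normal_sets_subset[OF assms(1)] assms(2)])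

lemma dm_completion_adjunction:
  assumes M: "M \<in> normal_sets A" and N: "N \<in> normal_sets A" and P: "P \<in> normal_sets A"
  shows "\<nabla>\<^bsub>dm_completion A\<^esub> P \<inter> M \<subseteq> N \<longleftrightarrow> P \<subseteq> M \<leadsto>\<^bsub>dm_completion A\<^esub> N"
proof -
  note sub = normal_sets_subset[OF M] normal_sets_subset[OF N] normal_sets_subset[OF P]
  show ?thesis
  proof
    assume le: "\<nabla>\<^bsub>dm_completion A\<^esub> P \<inter> M \<subseteq> N"
    have "\<nabla> p \<sqinter> m \<in> N" if p: "p \<in> P" and m: "m \<in> M" for p m
    proof -
      have c: "\<nabla> p \<in> carrier A" "m \<in> carrier A" using p m sub by auto
      have "\<nabla> p \<sqinter> m \<in> \<nabla>\<^bsub>dm_completion A\<^esub> P"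
        using c normal_sets_downward[OF nabla_dm_completion_normal[OF P]
            nabla_mem_nabla_dm_completion[OF P p]] by (simp add: meet_left)
      moreover have "\<nabla> p \<sqinter> m \<in> M"
        using c normal_sets_downward[OF M m] by (simp add: meet_right)
      ultimately show ?thesis using le by blast
    qed
    then show "P \<subseteq> M \<leadsto>\<^bsub>dm_completion A\<^esub> N" using sub by (auto simp: arrow_dm_completion)
  next
    assume le: "P \<subseteq> M \<leadsto>\<^bsub>dm_completion A\<^esub> N"
    show "\<nabla>\<^bsub>dm_completion A\<^esub> P \<inter> M \<subseteq> N"
    proof
      fix y assume y: "y \<in> \<nabla>\<^bsub>dm_completion A\<^esub> P \<inter> M"
      then have yc: "y \<in> carrier A" using sub by blast
      have "y \<sqsubseteq> u" if u: "u \<in> carrier A" "\<forall>n \<in> N. n \<sqsubseteq> u" for u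
      proof -
        \<comment> \<open>Here \<open>y\<close> plays two roles: it is the member of the join over
          \<open>P\<close> and, being in \<open>M\<close>, also the parameter \<open>z\<close>. The
          hypothesis puts each \<open>\<nabla> p \<sqinter> y\<close> into \<open>N\<close>, hence
          below \<open>u\<close>.\<close>
        have "y \<sqinter> y \<sqsubseteq> u"
          by (rule nabla_dm_completion_meet_le[OF P])
            (use y yc u le in \<open>auto simp: arrow_dm_completion\<close>)
        then show ?thesis using yc u by (meson le_trans le_refl meet_closed meet_le)
      qed
      with yc show "y \<in> N" unfolding mem_normal_iff[OF N] by blast
    qed
  qed
qed

lemma nabla_algebra_dm_completion: "nabla_algebra (dm_completion A)"
proof -
  interpret D: bounded_lattice "dm_completion A" by (rule bounded_lattice_dm_completion)
  show ?thesis
    by unfold_locales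
      (auto simp: nabla_dm_completion_normal arrow_dm_completion_normal meet_dm_completion
        dm_completion_adjunction)
qed

section \<open>The canonical embedding\<close>

lemma down_nabla:
  assumes "a \<in> carrier A"
  shows "down A (\<nabla> a) = \<nabla>\<^bsub>dm_completion A\<^esub> (down A a)"
proof
  have a: "a \<in> down A a" using assms by (simp add: down_def)
  show "down A (\<nabla> a) \<subseteq> \<nabla>\<^bsub>dm_completion A\<^esub> (down A a)"
    using normal_sets_downward[OF nabla_dm_completion_normal nabla_mem_nabla_dm_completion,
        OF down_normal down_normal a] assms
    by (auto simp: down_def)
  \<comment> \<open>By monotonicity \<open>\<nabla> a\<close> is the greatest element of the image
    of the ideal of \<open>a\<close>.\<close>
  show "\<nabla>\<^bsub>dm_completion A\<^esub> (down A a) \<subseteq> down A (\<nabla> a)"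
    using assms by (intro nabla_dm_completion_least down_normal)
      (auto simp: down_def intro: nabla_mono)
qed

lemma down_embedding: "nabla_embedding A (dm_completion A) (\<lambda>x. down A x)"
proof -
  have "lattice A" "bounded_lattice A" "nabla_algebra A" by unfold_locales
  moreover have "lattice (dm_completion A)"
    using bounded_lattice_dm_completion by (rule bounded_lattice.axioms)
  ultimately show ?thesis
    unfolding nabla_embedding_def nabla_morphism_def meet_pres_def join_pres_def
    using residual_down[OF nabla_closed adjunction]
    by (auto simp: nabla_algebra_dm_completion down_normal down_meet down_join down_top down_nabla
        meet_dm_completion join_dm_completion top_dm_completion bottom_dm_completion
        arrow_dm_completion inj_on_down)
qed


section \<open>Preservation of the conditions\<close>

lemma heyting_imp_dm_completion:
  assumes "is_heyting_imp A h"
  shows "is_heyting_imp (dm_completion A)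
    (\<lambda>M N. {x \<in> carrier A. \<forall>m \<in> M. x \<sqinter> m \<in> N})"
proof -
  have h: "h \<in> carrier A \<rightarrow> carrier A \<rightarrow> carrier A"
    and adj: "\<And>a b c. \<lbrakk>a \<in> carrier A; b \<in> carrier A; c \<in> carrier A\<rbrakk> \<Longrightarrow>
      c \<sqinter> a \<sqsubseteq> b \<longleftrightarrow> c \<sqsubseteq> h a b"
    using assms by (simp_all add: is_heyting_imp_def)
  have normal: "{x \<in> carrier A. \<forall>m \<in> M. x \<sqinter> m \<in> N} \<in> normal_sets A"
    if "M \<in> normal_sets A" "N \<in> normal_sets A" for M N
    using residual_normal[OF _ h adj normal_sets_subset[OF that(1)] that(2)] by simp
  have "P \<inter> M \<subseteq> N \<longleftrightarrow> P \<subseteq> {x \<in> carrier A. \<forall>m \<in> M. x \<sqinter> m \<in> N}"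
    if M: "M \<in> normal_sets A" and N: "N \<in> normal_sets A" and P: "P \<in> normal_sets A" for M N P
  proof
    note sub = normal_sets_subset[OF M] normal_sets_subset[OF P]
    assume le: "P \<inter> M \<subseteq> N"
    have "p \<sqinter> m \<in> P \<inter> M" if "p \<in> P" "m \<in> M" for p m
      using that sub normal_sets_downward[OF M, of m "p \<sqinter> m"]
        normal_sets_downward[OF P, of p "p \<sqinter> m"]
      by (auto simp: subset_eq meet_left meet_right)
    with le sub show "P \<subseteq> {x \<in> carrier A. \<forall>m \<in> M. x \<sqinter> m \<in> N}" by blast
  next
    assume le: "P \<subseteq> {x \<in> carrier A. \<forall>m \<in> M. x \<sqinter> m \<in> N}"
    show "P \<inter> M \<subseteq> N"
    proof
      fix y assume "y \<in> P \<inter> M"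
      \<comment> \<open>Both \<open>x\<close> and \<open>m\<close> are taken to be \<open>y\<close>,
        which lies in \<open>P\<close> and in \<open>M\<close>; then
        \<open>y \<sqsubseteq> y \<sqinter> y\<close> and downward closure of \<open>N\<close>
        finish.\<close>
      with le have "y \<in> carrier A" "y \<sqinter> y \<in> N" by auto
      then show "y \<in> N" by (auto intro: normal_sets_downward[OF N] meet_le)
    qed
  qed
  with normal show ?thesis by (simp add: is_heyting_imp_def meet_dm_completion)
qed

lemma down_heyting_morphism:
  assumes "satisfies A Cond_H"
  shows "heyting_nabla_morphism A (dm_completion A) (\<lambda>x. down A x)"
proof -
  obtain h where h: "is_heyting_imp A h" using assms by auto
  have "{x \<in> carrier A. \<forall>m \<in> down A a. x \<sqinter> m \<in> down A b} = down A (h a b)"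
    if "a \<in> carrier A" "b \<in> carrier A" for a b
    using residual_down[of "\<lambda>x. x" h a b] h that by (auto simp: is_heyting_imp_def)
  then show ?thesis
    unfolding heyting_nabla_morphism_def
    using down_embedding h heyting_imp_dm_completion[OF h]
    by (intro conjI exI[of _ h] exI[of _ "\<lambda>M N. {x \<in> carrier A. \<forall>m \<in> M. x \<sqinter> m \<in> N}"])
      (auto simp: nabla_embedding_def)
qed

section \<open>The conditions \<open>N\<close>, \<open>R\<close> and \<open>L\<close>\<close>

lemma nabla_dm_completion_Int:
  assumes N: "satisfies A Cond_N" and M: "M \<in> normal_sets A" and K: "K \<in> normal_sets A"
  shows "\<nabla>\<^bsub>dm_completion A\<^esub> (M \<inter> K) = \<nabla>\<^bsub>dm_completion A\<^esub> M \<inter> \<nabla>\<^bsub>dm_completion A\<^esub> K"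
proof
  note sub = normal_sets_subset[OF M] normal_sets_subset[OF K]
  have MK: "M \<inter> K \<in> normal_sets A" using Inter_normal[of "{M, K}" A] M K by simp
  show "\<nabla>\<^bsub>dm_completion A\<^esub> (M \<inter> K) \<subseteq> \<nabla>\<^bsub>dm_completion A\<^esub> M \<inter> \<nabla>\<^bsub>dm_completion A\<^esub> K"
    using M K MK
    by (intro Int_greatest nabla_dm_completion_least)
      (auto simp: nabla_dm_completion_normal nabla_mem_nabla_dm_completion)
  show "\<nabla>\<^bsub>dm_completion A\<^esub> M \<inter> \<nabla>\<^bsub>dm_completion A\<^esub> K \<subseteq> \<nabla>\<^bsub>dm_completion A\<^esub> (M \<inter> K)"
  proof
    fix y assume y: "y \<in> \<nabla>\<^bsub>dm_completion A\<^esub> M \<inter> \<nabla>\<^bsub>dm_completion A\<^esub> K"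
    then have yc: "y \<in> carrier A" using M by (simp add: mem_nabla_dm_completion)
    have "y \<sqsubseteq> u" if u: "u \<in> carrier A" "\<forall>n \<in> M \<inter> K. \<nabla> n \<sqsubseteq> u" for u
    proof -
      have mk: "\<nabla> m \<sqinter> \<nabla> k \<sqsubseteq> u" if "m \<in> M" "k \<in> K" for m k
      proof -
        have c: "m \<in> carrier A" "k \<in> carrier A" using that sub by auto
        have "m \<sqinter> k \<in> M \<inter> K"
          using that c normal_sets_downward[OF M, of m] normal_sets_downward[OF K, of k]
          by (simp add: meet_left meet_right)
        then have "\<nabla> (m \<sqinter> k) \<sqsubseteq> u" using u by blast
        with N c show ?thesis by auto
      qed
      \<comment> \<open>The residual estimate is applied once per factor: with
        \<open>z = \<nabla> k\<close> it replaces \<open>\<nabla> m\<close> by \<open>y\<close>, and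
        below with \<open>z = y\<close> it replaces \<open>\<nabla> k\<close> by
        \<open>y\<close>.\<close>
      have "y \<sqinter> \<nabla> k \<sqsubseteq> u" if k: "k \<in> K" for k
        by (rule nabla_dm_completion_meet_le[OF M]) (use y k sub u mk in auto)
      then have "\<nabla> k \<sqinter> y \<sqsubseteq> u" if "k \<in> K" for k using that by (simp add: meet_comm)
      then have "y \<sqinter> y \<sqsubseteq> u"
        by (rule nabla_dm_completion_meet_le[OF K, rotated -1]) (use y yc u in auto)
      then show ?thesis using yc u by (meson le_trans le_refl meet_closed meet_le)
    qed
    with yc show "y \<in> \<nabla>\<^bsub>dm_completion A\<^esub> (M \<inter> K)"
      using MK by (simp add: mem_nabla_dm_completion)
  qed
qed

text \<open>Since \<open>\<nabla> \<top> = \<top>\<close>, the image of the top ideal contains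
  \<open>\<top>\<close>, and a downward closed set containing \<open>\<top>\<close> is the whole
  carrier.\<close>

lemma dm_completion_Cond_N:
  assumes "satisfies A Cond_N"
  shows "satisfies (dm_completion A) Cond_N"
proof -
  have "\<nabla>\<^bsub>dm_completion A\<^esub> (carrier A) = carrier A"
  proof
    show "\<nabla>\<^bsub>dm_completion A\<^esub> (carrier A) \<subseteq> carrier A"
      by (intro normal_sets_subset nabla_dm_completion_normal carrier_normal)
    show "carrier A \<subseteq> \<nabla>\<^bsub>dm_completion A\<^esub> (carrier A)"
      using nabla_mem_nabla_dm_completion[OF carrier_normal top_closed] assms
        normal_sets_downward[OF nabla_dm_completion_normal[OF carrier_normal], of "\<top>"]
      by auto
  qed
  moreover have "M \<inter> N \<in> normal_sets A" if "M \<in> normal_sets A" "N \<in> normal_sets A" for M N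
    using Inter_normal[of "{M, N}" A] that by simp
  ultimately show ?thesis
    using nabla_dm_completion_Int[OF assms]
    by (simp add: top_dm_completion meet_dm_completion nabla_dm_completion_normal)
qed

lemma dm_completion_Cond_R:
  assumes "satisfies A Cond_R"
  shows "satisfies (dm_completion A) Cond_R"
proof -
  have "N \<subseteq> \<nabla>\<^bsub>dm_completion A\<^esub> N" if N: "N \<in> normal_sets A" for N
  proof
    fix n assume n: "n \<in> N"
    then have "n \<in> carrier A" using normal_sets_subset[OF N] by blast
    with assms n N show "n \<in> \<nabla>\<^bsub>dm_completion A\<^esub> N"
      using normal_sets_downward[OF nabla_dm_completion_normal nabla_mem_nabla_dm_completion]
      by auto
  qed
  then show ?thesis by simp
qed

lemma dm_completion_Cond_L:
  assumes "satisfies A Cond_L"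
  shows "satisfies (dm_completion A) Cond_L"
proof -
  have "\<nabla>\<^bsub>dm_completion A\<^esub> N \<subseteq> N" if N: "N \<in> normal_sets A" for N
  proof (rule nabla_dm_completion_least[OF N N])
    fix n assume n: "n \<in> N"
    then have "n \<in> carrier A" using normal_sets_subset[OF N] by blast
    with assms n show "\<nabla> n \<in> N" by (auto intro: normal_sets_downward[OF N])
  qed
  then show ?thesis by simp
qed

section \<open>Surjectivity of nabla and of box\<close>

lemma nabla_box_of_surj:
  assumes "satisfies A Cond_Fa" "b \<in> carrier A"
  shows "\<nabla> \<box> b = b"
proof -
  obtain c where c: "c \<in> carrier A" "b = \<nabla> c" using assms by force
  \<comment> \<open>The unit gives \<open>c \<sqsubseteq> \<box> \<nabla> c = \<box> b\<close>; the
    reverse inequality for \<open>b\<close> is the counit.\<close>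
  then have "\<nabla> c \<sqsubseteq> \<nabla> \<box> b" using assms by (auto intro!: nabla_mono simp: nabla_le_iff[symmetric])
  moreover have "\<nabla> \<box> b \<sqsubseteq> b" using assms by (simp add: nabla_le_iff)
  ultimately show ?thesis using assms c by (auto intro: le_antisym)
qed

lemma box_nabla_of_surj:
  assumes "satisfies A Cond_Fu" "b \<in> carrier A"
  shows "\<box> \<nabla> b = b"
proof -
  obtain a where a: "a \<in> carrier A" "b = \<box> a" using assms by force
  then have "\<nabla> b \<sqsubseteq> a" using assms by (simp add: nabla_le_iff)
  \<comment> \<open>The counit puts the left side below \<open>\<nabla> b\<close>. Transposing the
    result bounds \<open>\<box> \<nabla> b\<close> by \<open>\<box> a = b\<close>.\<close>
  then have "\<nabla> \<box> \<nabla> b \<sqsubseteq> a"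
    using a assms by (meson box_in_carrier le_refl le_trans nabla_in_carrier nabla_le_iff)
  then have "\<box> \<nabla> b \<sqsubseteq> b" using a assms by (simp add: nabla_le_iff)
  moreover have "b \<sqsubseteq> \<box> \<nabla> b" using assms by (simp add: nabla_le_iff[symmetric])
  ultimately show ?thesis using assms by (auto intro: le_antisym)
qed

text \<open>The antecedent is the whole carrier, and as \<open>N\<close> is downward closed the test
  at \<open>m = \<top>\<close> implies all the others.\<close>

lemma box_dm_completion:
  assumes N: "N \<in> normal_sets A"
  shows "\<box>\<^bsub>dm_completion A\<^esub> N = {x \<in> carrier A. \<nabla> x \<in> N}"
proof -
  have "(\<forall>m \<in> carrier A. \<nabla> x \<sqinter> m \<in> N) \<longleftrightarrow> \<nabla> x \<in> N" if "x \<in> carrier A" for x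
    using that meet_top[of "\<nabla> x"] top_closed normal_sets_downward[OF N, of "\<nabla> x"]
    by (metis meet_closed meet_left nabla_in_carrier)
  then show ?thesis by (auto simp: box_def arrow_dm_completion top_dm_completion)
qed

lemma box_dm_completion_normal:
  assumes "N \<in> normal_sets A"
  shows "\<box>\<^bsub>dm_completion A\<^esub> N \<in> normal_sets A"
  unfolding box_def top_dm_completion
  by (rule arrow_dm_completion_normal[OF carrier_normal assms])

text \<open>A preimage of \<open>N\<close> is its box: each \<open>n\<close> in \<open>N\<close>
  equals \<open>\<nabla> \<box> n\<close>, where \<open>\<box> n\<close> belongs to the box of
  \<open>N\<close>.\<close>

lemma dm_completion_Cond_Fa:
  assumes "satisfies A Cond_Fa"
  shows "satisfies (dm_completion A) Cond_Fa"
proof -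
  have "\<nabla>\<^bsub>dm_completion A\<^esub> (\<box>\<^bsub>dm_completion A\<^esub> N) = N" if N: "N \<in> normal_sets A" for N
  proof
    show "\<nabla>\<^bsub>dm_completion A\<^esub> (\<box>\<^bsub>dm_completion A\<^esub> N) \<subseteq> N"
      using N by (intro nabla_dm_completion_least box_dm_completion_normal)
        (auto simp: box_dm_completion)
    show "N \<subseteq> \<nabla>\<^bsub>dm_completion A\<^esub> (\<box>\<^bsub>dm_completion A\<^esub> N)"
    proof
      fix n assume n: "n \<in> N"
      then have "n \<in> carrier A" using normal_sets_subset[OF N] by blast
      then have eq: "\<nabla> \<box> n = n" and "\<box> n \<in> carrier A"
        using nabla_box_of_surj[OF assms] by simp_all
      then have "\<box> n \<in> \<box>\<^bsub>dm_completion A\<^esub> N"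
        using N n by (simp add: box_dm_completion)
      then show "n \<in> \<nabla>\<^bsub>dm_completion A\<^esub> (\<box>\<^bsub>dm_completion A\<^esub> N)"
        using nabla_mem_nabla_dm_completion[OF box_dm_completion_normal[OF N]] eq by metis
    qed
  qed
  then have "N \<in> nabla (dm_completion A) ` normal_sets A" if "N \<in> normal_sets A" for N
    using that box_dm_completion_normal by (metis image_eqI)
  then show ?thesis by (auto simp: nabla_dm_completion_normal)
qed

text \<open>A preimage of \<open>N\<close> under the box is its \<open>nabla\<close>.\<close>

lemma dm_completion_Cond_Fu:
  assumes "satisfies A Cond_Fu"
  shows "satisfies (dm_completion A) Cond_Fu"
proof -
  have "\<box>\<^bsub>dm_completion A\<^esub> (\<nabla>\<^bsub>dm_completion A\<^esub> N) = N" if N: "N \<in> normal_sets A" for N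
  proof
    show "\<box>\<^bsub>dm_completion A\<^esub> (\<nabla>\<^bsub>dm_completion A\<^esub> N) \<subseteq> N"
    proof
      fix x assume "x \<in> \<box>\<^bsub>dm_completion A\<^esub> (\<nabla>\<^bsub>dm_completion A\<^esub> N)"
      then have x: "x \<in> carrier A" "\<nabla> x \<in> \<nabla>\<^bsub>dm_completion A\<^esub> N"
        using N by (simp_all add: box_dm_completion nabla_dm_completion_normal)
      have "x \<sqsubseteq> u" if u: "u \<in> carrier A" "\<forall>n \<in> N. n \<sqsubseteq> u" for u
      proof -
        \<comment> \<open>Upper bounds of \<open>N\<close> are pushed forward along
          \<open>nabla\<close>; transposing \<open>\<nabla> x \<sqsubseteq> \<nabla> u\<close> and
          cancelling \<open>\<box> \<nabla> u = u\<close> brings the bound back to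
          \<open>x\<close>.\<close>
        have "\<forall>n \<in> N. \<nabla> n \<sqsubseteq> \<nabla> u"
          using u normal_sets_subset[OF N] by (simp add: nabla_mono subset_iff)
        then have "\<nabla> x \<sqsubseteq> \<nabla> u" using x u N by (simp add: mem_nabla_dm_completion)
        then have "x \<sqsubseteq> \<box> \<nabla> u" using x u nabla_le_iff[of x "\<nabla> u"] by simp
        then show ?thesis by (simp only: box_nabla_of_surj[OF assms u(1)])
      qed
      with x(1) show "x \<in> N" unfolding mem_normal_iff[OF N] by blast
    qed
    show "N \<subseteq> \<box>\<^bsub>dm_completion A\<^esub> (\<nabla>\<^bsub>dm_completion A\<^esub> N)"
      using N normal_sets_subset[OF N]
      by (simp add: box_dm_completion nabla_dm_completion_normal nabla_mem_nabla_dm_completion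
          subset_iff)
  qed
  then have "N \<in> box (dm_completion A) ` normal_sets A" if "N \<in> normal_sets A" for N
    using that nabla_dm_completion_normal by (metis image_eqI)
  then show ?thesis by (auto simp: box_dm_completion_normal)
qed

lemma dm_completion_satisfies:
  assumes "satisfies A c"
  shows "satisfies (dm_completion A) c"
proof (cases c)
  case Cond_H
  then show ?thesis using assms heyting_imp_dm_completion by auto
qed (use assms dm_completion_Cond_N dm_completion_Cond_R dm_completion_Cond_L
    dm_completion_Cond_Fa dm_completion_Cond_Fu in blast)+

end

theorem theorem5p3:
  fixes A :: "'a nabla_alg" and C :: "condition set"
  assumes "A \<in> variety C"
  shows "dm_completion A \<in> variety C
    \<and> nabla_embedding A (dm_completion A) (\<lambda>x. down A x)
    \<and> (Cond_H \<in> C \<longrightarrow> heyting_nabla_morphism A (dm_completion A) (\<lambda>x. down A x))"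
proof -
  interpret nabla_algebra A using assms by (simp add: variety_def)
  have "satisfies A c" if "c \<in> C" for c using assms that by (simp add: variety_def)
  then show ?thesis
    using nabla_algebra_dm_completion dm_completion_satisfies down_embedding down_heyting_morphism
    unfolding variety_def by blast
qed

end
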